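(* Let $G$ be a finitely generated group. Then the following statements are equivalent: (1) $G$ is nilpotent; (2) $G = C_n(G)$ for some positive integer $n$; (3) $G/C_m(G)$ is nilpotent for some positive integer $m$.
   Context: For a group $G$ and $a\in G$, $C_G(a)$ denotes the centralizer of $a$ in $G$, and $N_G(K)$ denotes the normalizer in $G$ of a subgroup $K$. Define $C(G)=\bigcap_{a\in G} N_G(C_G(a))$, a characteristic subgroup of $G$. The ascending series of characteristic subgroups $C_i(G)$ is defined by $C_0(G)=1$ and $C_{i+1}(G)/C_i(G)=C(G/C_i(G))$ for $i\geq 0$ (that is, $C_{i+1}(G)$ is the full preimage in $G$ of $C(G/C_i(G))$); in particular $C_1(G)=C(G)$. *)

theory Defs
  imports "HOL-Algebra.Algebra"
begin

definition finitely_generated :: "('a, 'b) monoid_scheme \<Rightarrow> bool" where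
  "finitely_generated G \<longleftrightarrow>
     (\<exists>S. finite S \<and> S \<subseteq> carrier G \<and> generate G S = carrier G)"

definition group_center :: "('a, 'b) monoid_scheme \<Rightarrow> 'a set" where
  "group_center G = {z \<in> carrier G. \<forall>x \<in> carrier G. z \<otimes>\<^bsub>G\<^esub> x = x \<otimes>\<^bsub>G\<^esub> z}"

text \<open>A group is nilpotent if it has a finite central series, i.e. a chain of normal
  subgroups from the trivial subgroup to the whole group in which the image of each term is
  central in the quotient by the preceding term.\<close>

definition nilpotent :: "('a, 'b) monoid_scheme \<Rightarrow> bool" where
  "nilpotent G \<longleftrightarrow>
     (\<exists>(n::nat) K. K 0 = {\<one>\<^bsub>G\<^esub>} \<and> K n = carrier G \<and>
        (\<forall>i\<le>n. K i \<lhd> G) \<and>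
        (\<forall>i<n. K i \<subseteq> K (Suc i) \<and>
               (\<lambda>x. K i #>\<^bsub>G\<^esub> x) ` K (Suc i) \<subseteq> group_center (G Mod K i)))"

definition centralizer :: "('a, 'b) monoid_scheme \<Rightarrow> 'a \<Rightarrow> 'a set" where
  "centralizer G a = {x \<in> carrier G. x \<otimes>\<^bsub>G\<^esub> a = a \<otimes>\<^bsub>G\<^esub> x}"

definition centralizer_norm :: "('a, 'b) monoid_scheme \<Rightarrow> 'a set" where
  "centralizer_norm G = (\<Inter>a \<in> carrier G. normalizer G (centralizer G a))"

primrec centralizer_norm_series :: "('a, 'b) monoid_scheme \<Rightarrow> nat \<Rightarrow> 'a set" where
  "centralizer_norm_series G 0 = {\<one>\<^bsub>G\<^esub>}"
| "centralizer_norm_series G (Suc i) =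
     {x \<in> carrier G. centralizer_norm_series G i #>\<^bsub>G\<^esub> x
        \<in> centralizer_norm (G Mod centralizer_norm_series G i)}"

end

theory Submission
  imports Defs
begin

text \<open>
  A central series lies term by term inside the series \<open>C\<^sub>i(G)\<close>, because elements that are
  central in a quotient normalize every centralizer there; this gives (1) implies (2), and (2)
  implies (3) is immediate. The content is (3) implies (1). By descent along \<open>C\<^sub>i(G)\<close> it is
  enough to show that, in a group generated by \<open>n\<close> elements, \<open>C(G)\<close> lies in the term with index
  \<open>n + 1\<close> of the upper central series: then a quotient that becomes trivial after finitely many
  central steps above \<open>C\<^sub>i\<^sub>+\<^sub>1(G)\<close> does so after finitely many central steps above
  \<open>C\<^sub>i(G)\<close>, and finally above \<open>1\<close>.

  Let \<open>x \<in> C(G)\<close>. For every \<open>g\<close>, the conjugate of \<open>g\<close> by \<open>x\<close> has the same centralizer as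
  \<open>g\<close>, so it commutes with \<open>g\<close>, and hence \<open>[g,[g,x]] = 1\<close> (\<open>centralizer_norm_right_engel\<close>).
  Applied to \<open>g\<close> and to \<open>gx\<close>, this shows that \<open>x\<close> commutes with its conjugates
  (\<open>centralizer_norm_commute_conj\<close>). So \<open>x\<close> lies in an abelian normal subgroup \<open>V\<close> contained in
  \<open>C(G)\<close>. Written additively, \<open>V\<close> is a module on which every operator \<open>\<alpha>\<^sub>g = g - 1\<close>, which is
  \<open>v \<mapsto> [g,v]\<close>, has square zero. Expanding \<open>\<alpha>\<^sub>g\<^sub>h\<^sup>2 = 0\<close> shows that these operators
  anticommute (\<open>commutators_anticommute\<close>). Therefore a product of such operators belonging to
  generators vanishes as soon as a generator is repeated, in particular when it has \<open>n + 1\<close>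
  factors (\<open>in_upper_central\<close>).
\<close>

section \<open>The upper central series above a normal subgroup\<close>

text \<open>With this order of the arguments and this choice of inverses, \<open>commutator G g\<close> restricted to
  an abelian normal subgroup is the operator \<open>g - 1\<close> of the conjugation action.\<close>

definition commutator :: "('a, 'b) monoid_scheme \<Rightarrow> 'a \<Rightarrow> 'a \<Rightarrow> 'a" where
  "commutator G g x = g \<otimes>\<^bsub>G\<^esub> x \<otimes>\<^bsub>G\<^esub> inv\<^bsub>G\<^esub> g \<otimes>\<^bsub>G\<^esub> inv\<^bsub>G\<^esub> x"

text \<open>The preimage in \<open>G\<close> of the upper central series of \<open>G/N\<close>. Stating everything about
  preimages avoids quotients of quotients when the series \<open>C\<^sub>i(G)\<close> is descended.\<close>

primrec upper_central_over :: "('a, 'b) monoid_scheme \<Rightarrow> 'a set \<Rightarrow> nat \<Rightarrow> 'a set" where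
  "upper_central_over G N 0 = N"
| "upper_central_over G N (Suc i) =
     {x \<in> carrier G. \<forall>g \<in> carrier G. commutator G g x \<in> upper_central_over G N i}"

context group
begin

lemma inv_mult_cancel_left:
  "x \<in> carrier G \<Longrightarrow> y \<in> carrier G \<Longrightarrow> inv x \<otimes> (x \<otimes> y) = y"
  "x \<in> carrier G \<Longrightarrow> y \<in> carrier G \<Longrightarrow> x \<otimes> (inv x \<otimes> y) = y"
  by (simp_all add: m_assoc [symmetric])

lemmas word_simps = m_assoc inv_mult_group inv_mult_cancel_left

lemma commutator_closed [simp, intro]:
  "g \<in> carrier G \<Longrightarrow> x \<in> carrier G \<Longrightarrow> commutator G g x \<in> carrier G"
  by (simp add: commutator_def)

lemma commutator_one [simp]: "g \<in> carrier G \<Longrightarrow> commutator G g \<one> = \<one>"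
  by (simp add: commutator_def)

lemma commutator_mult_left:
  assumes "g \<in> carrier G" "h \<in> carrier G" "x \<in> carrier G"
  shows "commutator G (g \<otimes> h) x = g \<otimes> commutator G h x \<otimes> inv g \<otimes> commutator G g x"
  using assms by (simp add: commutator_def word_simps)

lemma commutator_inv_left:
  assumes "g \<in> carrier G" "x \<in> carrier G"
  shows "commutator G (inv g) x = inv g \<otimes> inv (commutator G g x) \<otimes> g"
  using assms by (simp add: commutator_def word_simps)

lemma commutator_mult_right:
  assumes "g \<in> carrier G" "x \<in> carrier G" "y \<in> carrier G"
  shows "commutator G g (x \<otimes> y) = commutator G g x \<otimes> (x \<otimes> commutator G g y \<otimes> inv x)"
  using assms by (simp add: commutator_def word_simps)

lemma commutator_inv_right:
  assumes "g \<in> carrier G" "x \<in> carrier G"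
  shows "commutator G g (inv x) = inv x \<otimes> inv (commutator G g x) \<otimes> x"
  using assms by (simp add: commutator_def word_simps)

lemma commutator_conj_right:
  assumes "g \<in> carrier G" "h \<in> carrier G" "x \<in> carrier G"
  shows "commutator G g (h \<otimes> x \<otimes> inv h) = h \<otimes> commutator G (inv h \<otimes> g \<otimes> h) x \<otimes> inv h"
  using assms by (simp add: commutator_def word_simps)

lemma commutator_eq_one_iff:
  assumes "g \<in> carrier G" "x \<in> carrier G"
  shows "commutator G g x = \<one> \<longleftrightarrow> g \<otimes> x = x \<otimes> g"
proof -
  have *: "commutator G g x = (g \<otimes> x) \<otimes> inv (x \<otimes> g)"
    using assms by (simp add: commutator_def word_simps)
  show ?thesis
    unfolding * using assms by (metis inv_equality inv_inv inv_closed m_closed r_inv)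
qed

lemma upper_central_over_subset:
  "N \<subseteq> carrier G \<Longrightarrow> upper_central_over G N i \<subseteq> carrier G"
  by (cases i) auto

lemma normal_in_carrier: "N \<lhd> G \<Longrightarrow> x \<in> N \<Longrightarrow> x \<in> carrier G"
  by (rule subgroup.mem_carrier [OF normal_imp_subgroup])

lemma commutator_in_normal:
  assumes "N \<lhd> G" "x \<in> N" "g \<in> carrier G"
  shows "commutator G g x \<in> N"
proof -
  interpret normal N G by fact
  show ?thesis
    unfolding commutator_def using assms by (simp add: inv_op_closed2)
qed

lemma upper_central_over_normal:
  assumes "N \<lhd> G"
  shows "upper_central_over G N i \<lhd> G"
proof (induction i)
  case 0
  then show ?case using assms by simp
next
  case (Suc i)
  let ?U = "upper_central_over G N i"
  interpret U: normal ?U G by fact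
  show ?case
  proof (rule normal_invI)
    show "subgroup (upper_central_over G N (Suc i)) G"
    proof
      fix x y
      assume "x \<in> upper_central_over G N (Suc i)" "y \<in> upper_central_over G N (Suc i)"
      then show "x \<otimes> y \<in> upper_central_over G N (Suc i)"
        by (simp add: commutator_mult_right U.inv_op_closed2)
    next
      fix x
      assume "x \<in> upper_central_over G N (Suc i)"
      then show "inv x \<in> upper_central_over G N (Suc i)"
        by (simp add: commutator_inv_right U.inv_op_closed1)
    qed auto
  next
    fix h x
    assume "h \<in> carrier G" "x \<in> upper_central_over G N (Suc i)"
    then show "h \<otimes> x \<otimes> inv h \<in> upper_central_over G N (Suc i)"
      by (simp add: commutator_conj_right U.inv_op_closed2)
  qed
qed

lemma upper_central_over_Suc_mono:
  assumes "N \<lhd> G"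
  shows "upper_central_over G N i \<subseteq> upper_central_over G N (Suc i)"
  using commutator_in_normal [OF upper_central_over_normal [OF assms]]
    normal_in_carrier [OF upper_central_over_normal [OF assms]]
  by (auto simp del: upper_central_over.simps(1))

lemma upper_central_over_mono:
  "N \<subseteq> M \<Longrightarrow> upper_central_over G N i \<subseteq> upper_central_over G M i"
  by (induction i) auto

lemma upper_central_over_add:
  "upper_central_over G (upper_central_over G N k) i = upper_central_over G N (i + k)"
  by (induction i) auto

lemma coset_eq_self_iff:
  assumes "subgroup N G" "x \<in> carrier G"
  shows "N #> x = N \<longleftrightarrow> x \<in> N"
  using assms coset_join1 coset_join2 by blast

lemma group_hom_quotient:
  assumes "N \<lhd> G"
  shows "group_hom G (G Mod N) (\<lambda>x. N #> x)"
  unfolding group_hom_def group_hom_axioms_def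
  using normal.r_coset_hom_Mod [OF assms] normal.factorgroup_is_group [OF assms] by simp

lemma commutator_quotient:
  assumes "N \<lhd> G" "g \<in> carrier G" "x \<in> carrier G"
  shows "commutator (G Mod N) (N #> g) (N #> x) = N #> commutator G g x"
proof -
  interpret hom: group_hom G "G Mod N" "\<lambda>x. N #> x"
    by (rule group_hom_quotient) fact
  show ?thesis
    using assms(2,3) by (simp add: commutator_def del: mult_FactGroup)
qed

lemma upper_central_over_quotient_iff:
  assumes "N \<lhd> G" "x \<in> carrier G"
  shows "N #> x \<in> upper_central_over (G Mod N) {\<one>\<^bsub>G Mod N\<^esub>} i \<longleftrightarrow> x \<in> upper_central_over G N i"
  using assms(2)
proof (induction i arbitrary: x)
  case 0
  then show ?case
    by (simp add: coset_eq_self_iff [OF normal_imp_subgroup [OF assms(1)]])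
next
  case (Suc i)
  then show ?case
    by (auto simp: carrier_FactGroup commutator_quotient [OF assms(1)])
qed

lemma quotient_central_iff:
  assumes "N \<lhd> G" "x \<in> carrier G"
  shows "N #> x \<in> group_center (G Mod N) \<longleftrightarrow> (\<forall>g \<in> carrier G. commutator G g x \<in> N)"
proof -
  interpret Q: group "G Mod N"
    by (rule normal.factorgroup_is_group) fact
  have "N #> x \<in> group_center (G Mod N) \<longleftrightarrow>
      (\<forall>g \<in> carrier G. commutator (G Mod N) (N #> g) (N #> x) = \<one>\<^bsub>G Mod N\<^esub>)"
    using assms(2) Q.commutator_eq_one_iff [of "N #> _" "N #> x"]
    unfolding group_center_def by (auto simp: carrier_FactGroup)
  then show ?thesis
    using assms by (simp add: commutator_quotient coset_eq_self_iff normal_imp_subgroup)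
qed

lemma nilpotent_iff_upper_central:
  "nilpotent G \<longleftrightarrow> (\<exists>n. upper_central_over G {\<one>} n = carrier G)"
proof
  assume "nilpotent G"
  then obtain n K where K: "K 0 = {\<one>}" "K n = carrier G" "\<forall>i\<le>n. K i \<lhd> G"
    and central: "\<forall>i<n. K i \<subseteq> K (Suc i) \<and>
      (\<lambda>x. K i #> x) ` K (Suc i) \<subseteq> group_center (G Mod K i)"
    unfolding nilpotent_def by (elim exE conjE)
  have "K i \<subseteq> upper_central_over G {\<one>} i" if "i \<le> n" for i
    using that
  proof (induction i)
    case 0
    then show ?case using K by simp
  next
    case (Suc i)
    show ?case
    proof
      fix x
      assume x: "x \<in> K (Suc i)"
      then have xG: "x \<in> carrier G"
        using K(3) Suc.prems normal_in_carrier by blast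
      have "K i #> x \<in> group_center (G Mod K i)"
        using central x Suc.prems by (auto simp: image_subset_iff)
      then have "\<forall>g \<in> carrier G. commutator G g x \<in> K i"
        using quotient_central_iff K(3) Suc.prems xG by simp
      then show "x \<in> upper_central_over G {\<one>} (Suc i)"
        using xG Suc by auto
    qed
  qed
  from this [of n] have "upper_central_over G {\<one>} n = carrier G"
    using K(2) upper_central_over_subset [of "{\<one>}" n] by auto
  then show "\<exists>n. upper_central_over G {\<one>} n = carrier G"
    by blast
next
  assume "\<exists>n. upper_central_over G {\<one>} n = carrier G"
  then obtain n where n: "upper_central_over G {\<one>} n = carrier G" by blast
  let ?K = "upper_central_over G {\<one>}"
  have normal: "?K i \<lhd> G" for i
    by (rule upper_central_over_normal [OF one_is_normal])
  have "(\<lambda>x. ?K i #> x) ` ?K (Suc i) \<subseteq> group_center (G Mod ?K i)" for i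
    using quotient_central_iff [OF normal] by auto
  then show "nilpotent G"
    unfolding nilpotent_def
    using n normal upper_central_over_Suc_mono [OF one_is_normal]
    by (intro exI [of _ n] exI [of _ ?K]) (simp del: upper_central_over.simps(2))
qed

lemma nilpotent_quotient_iff:
  assumes "N \<lhd> G"
  shows "nilpotent (G Mod N) \<longleftrightarrow> (\<exists>n. upper_central_over G N n = carrier G)"
proof -
  interpret Q: group "G Mod N"
    by (rule normal.factorgroup_is_group) fact
  have "upper_central_over (G Mod N) {\<one>\<^bsub>G Mod N\<^esub>} n = carrier (G Mod N) \<longleftrightarrow>
      upper_central_over G N n = carrier G" for n
  proof -
    have "upper_central_over (G Mod N) {\<one>\<^bsub>G Mod N\<^esub>} n = carrier (G Mod N) \<longleftrightarrow>
        (\<forall>x \<in> carrier G. N #> x \<in> upper_central_over (G Mod N) {\<one>\<^bsub>G Mod N\<^esub>} n)"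
      using Q.upper_central_over_subset [of "{\<one>\<^bsub>G Mod N\<^esub>}" n] Q.one_closed
      by (auto simp: carrier_FactGroup)
    also have "\<dots> \<longleftrightarrow> upper_central_over G N n = carrier G"
      using upper_central_over_quotient_iff [OF assms] upper_central_over_subset [of N n]
        normal_in_carrier [OF assms] by blast
    finally show ?thesis .
  qed
  then show ?thesis
    unfolding Q.nilpotent_iff_upper_central by simp
qed

section \<open>The norm of centralizers\<close>

lemma conj_image_centralizer:
  assumes "x \<in> carrier G" "a \<in> carrier G"
  shows "x <# centralizer G a #> inv x = centralizer G (x \<otimes> a \<otimes> inv x)"
proof
  show "x <# centralizer G a #> inv x \<subseteq> centralizer G (x \<otimes> a \<otimes> inv x)"
    using assms by (auto simp: l_coset_def r_coset_def centralizer_def word_simps)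
      (metis m_assoc inv_closed)
  show "centralizer G (x \<otimes> a \<otimes> inv x) \<subseteq> x <# centralizer G a #> inv x"
  proof
    fix b
    assume "b \<in> centralizer G (x \<otimes> a \<otimes> inv x)"
    then have b: "b \<in> carrier G" "b \<otimes> (x \<otimes> a \<otimes> inv x) = (x \<otimes> a \<otimes> inv x) \<otimes> b"
      by (auto simp: centralizer_def)
    have "inv x \<otimes> b \<otimes> x \<otimes> a = inv x \<otimes> (b \<otimes> (x \<otimes> a \<otimes> inv x)) \<otimes> x"
      using assms b(1) by (simp add: word_simps)
    also have "\<dots> = a \<otimes> (inv x \<otimes> b \<otimes> x)"
      unfolding b(2) using assms b(1) by (simp add: word_simps)
    finally have "inv x \<otimes> b \<otimes> x \<in> centralizer G a"
      using assms b(1) by (simp add: centralizer_def)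
    moreover have "b = x \<otimes> (inv x \<otimes> b \<otimes> x) \<otimes> inv x"
      using assms b(1) by (simp add: word_simps)
    ultimately show "b \<in> x <# centralizer G a #> inv x"
      unfolding l_coset_def r_coset_def by blast
  qed
qed

lemma centralizer_norm_iff:
  "x \<in> centralizer_norm G \<longleftrightarrow> x \<in> carrier G \<and>
     (\<forall>a \<in> carrier G. centralizer G (x \<otimes> a \<otimes> inv x) = centralizer G a)"
proof -
  have sub: "centralizer G a \<subseteq> carrier G" for a
    by (auto simp: centralizer_def)
  have "x \<in> normalizer G (centralizer G a) \<longleftrightarrow>
      x \<in> carrier G \<and> centralizer G (x \<otimes> a \<otimes> inv x) = centralizer G a"
    if "a \<in> carrier G" for a
    using that sub by (auto simp: normalizer_def stabilizer_def conj_image_centralizer)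
  then show ?thesis
    unfolding centralizer_norm_def by auto
qed

lemma centralizer_norm_conj_commute:
  assumes "x \<in> centralizer_norm G" "a \<in> carrier G" "b \<in> carrier G" "a \<otimes> b = b \<otimes> a"
  shows "x \<otimes> a \<otimes> inv x \<otimes> b = b \<otimes> (x \<otimes> a \<otimes> inv x)"
proof -
  have "b \<in> centralizer G a"
    using assms by (simp add: centralizer_def)
  then have "b \<in> centralizer G (x \<otimes> a \<otimes> inv x)"
    using assms centralizer_norm_iff by blast
  then show ?thesis
    by (simp add: centralizer_def)
qed

lemma centralizer_norm_normal: "centralizer_norm G \<lhd> G"
proof (rule normal_invI)
  show "subgroup (centralizer_norm G) G"
  proof
    show "centralizer_norm G \<subseteq> carrier G"
      using centralizer_norm_iff by blast
    show "\<one> \<in> centralizer_norm G"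
      by (simp add: centralizer_norm_iff)
  next
    fix x y
    assume x: "x \<in> centralizer_norm G" and y: "y \<in> centralizer_norm G"
    have "centralizer G (x \<otimes> y \<otimes> a \<otimes> inv (x \<otimes> y)) = centralizer G a" if a: "a \<in> carrier G" for a
    proof -
      have "x \<otimes> y \<otimes> a \<otimes> inv (x \<otimes> y) = x \<otimes> (y \<otimes> a \<otimes> inv y) \<otimes> inv x"
        using a x y by (simp add: centralizer_norm_iff word_simps)
      then show ?thesis
        using a x y by (simp add: centralizer_norm_iff)
    qed
    then show "x \<otimes> y \<in> centralizer_norm G"
      using x y by (simp add: centralizer_norm_iff)
  next
    fix x
    assume x: "x \<in> centralizer_norm G"
    then have xG: "x \<in> carrier G"
      by (simp add: centralizer_norm_iff)
    have "centralizer G (inv x \<otimes> a \<otimes> inv (inv x)) = centralizer G a" if a: "a \<in> carrier G" for a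
    proof -
      have "centralizer G (x \<otimes> (inv x \<otimes> a \<otimes> x) \<otimes> inv x) = centralizer G (inv x \<otimes> a \<otimes> x)"
        using x xG a by (simp add: centralizer_norm_iff)
      moreover have "x \<otimes> (inv x \<otimes> a \<otimes> x) \<otimes> inv x = a"
        using xG a by (simp add: word_simps)
      ultimately show ?thesis
        using xG by simp
    qed
    then show "inv x \<in> centralizer_norm G"
      using xG by (simp add: centralizer_norm_iff)
  qed
next
  fix h x
  assume h: "h \<in> carrier G" and x: "x \<in> centralizer_norm G"
  then have xG: "x \<in> carrier G"
    by (simp add: centralizer_norm_iff)
  have "centralizer G (h \<otimes> x \<otimes> inv h \<otimes> a \<otimes> inv (h \<otimes> x \<otimes> inv h)) = centralizer G a"
    if a: "a \<in> carrier G" for a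
  proof -
    let ?b = "inv h \<otimes> a \<otimes> h"
    have "h \<otimes> x \<otimes> inv h \<otimes> a \<otimes> inv (h \<otimes> x \<otimes> inv h) = h \<otimes> (x \<otimes> ?b \<otimes> inv x) \<otimes> inv h"
      using a h xG by (simp add: word_simps)
    then have "centralizer G (h \<otimes> x \<otimes> inv h \<otimes> a \<otimes> inv (h \<otimes> x \<otimes> inv h)) =
        h <# centralizer G (x \<otimes> ?b \<otimes> inv x) #> inv h"
      using a h xG by (simp add: conj_image_centralizer)
    also have "\<dots> = h <# centralizer G ?b #> inv h"
      using a h x by (simp add: centralizer_norm_iff)
    also have "\<dots> = centralizer G (h \<otimes> ?b \<otimes> inv h)"
      using a h by (simp add: conj_image_centralizer)
    also have "h \<otimes> ?b \<otimes> inv h = a"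
      using a h by (simp add: word_simps)
    finally show ?thesis .
  qed
  then show "h \<otimes> x \<otimes> inv h \<in> centralizer_norm G"
    using h xG by (simp add: centralizer_norm_iff)
qed

lemma group_center_subset_centralizer_norm: "group_center G \<subseteq> centralizer_norm G"
proof
  fix x
  assume "x \<in> group_center G"
  then have "x \<in> carrier G" "\<And>a. a \<in> carrier G \<Longrightarrow> x \<otimes> a \<otimes> inv x = a"
    by (auto simp: group_center_def m_assoc)
  then show "x \<in> centralizer_norm G"
    by (simp add: centralizer_norm_iff)
qed

lemma vimage_quotient_normal:
  assumes "N \<lhd> G" "M \<lhd> G Mod N"
  shows "{x \<in> carrier G. N #> x \<in> M} \<lhd> G"
proof -
  interpret hom: group_hom G "G Mod N" "\<lambda>x. N #> x"
    by (rule group_hom_quotient) fact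
  interpret M: normal M "G Mod N" by fact
  show ?thesis
  proof (rule normal_invI)
    show "subgroup {x \<in> carrier G. N #> x \<in> M} G"
      by unfold_locales (auto simp del: mult_FactGroup one_FactGroup)
  qed (auto simp del: mult_FactGroup simp: M.inv_op_closed2)
qed

lemma centralizer_norm_series_normal: "centralizer_norm_series G i \<lhd> G"
proof (induction i)
  case 0
  then show ?case by (simp add: one_is_normal)
next
  case (Suc i)
  interpret Q: group "G Mod centralizer_norm_series G i"
    by (rule normal.factorgroup_is_group) fact
  show ?case
    using vimage_quotient_normal [OF Suc Q.centralizer_norm_normal] by simp
qed

lemma upper_central_subset_centralizer_norm_series:
  "upper_central_over G {\<one>} i \<subseteq> centralizer_norm_series G i"
proof (induction i)
  case 0
  then show ?case by simp
next
  case (Suc i)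
  let ?C = "centralizer_norm_series G i"
  interpret Q: group "G Mod ?C"
    by (rule normal.factorgroup_is_group [OF centralizer_norm_series_normal])
  show ?case
  proof
    fix x
    assume "x \<in> upper_central_over G {\<one>} (Suc i)"
    then have x: "x \<in> carrier G" "\<forall>g \<in> carrier G. commutator G g x \<in> ?C"
      using Suc by auto
    then have "?C #> x \<in> group_center (G Mod ?C)"
      using quotient_central_iff [OF centralizer_norm_series_normal] by blast
    then show "x \<in> centralizer_norm_series G (Suc i)"
      using Q.group_center_subset_centralizer_norm x(1) by auto
  qed
qed

text \<open>The conjugate of \<open>g\<close> by \<open>x\<close> commutes with \<open>g\<close>, because \<open>g\<close> centralizes \<open>g\<close>, and the
  commutator of \<open>g\<close> and \<open>x\<close> is \<open>g\<close> times the inverse of that conjugate.\<close>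

lemma centralizer_norm_right_engel:
  assumes "x \<in> centralizer_norm G" "g \<in> carrier G"
  shows "commutator G g (commutator G g x) = \<one>"
proof -
  have xG: "x \<in> carrier G"
    using assms by (simp add: centralizer_norm_iff)
  let ?c = "x \<otimes> g \<otimes> inv x"
  have cG: "?c \<in> carrier G"
    using assms xG by simp
  have "?c \<otimes> g = g \<otimes> ?c"
    using centralizer_norm_conj_commute [OF assms assms(2)] by simp
  then have "inv ?c \<otimes> (?c \<otimes> g) \<otimes> inv ?c = inv ?c \<otimes> (g \<otimes> ?c) \<otimes> inv ?c"
    by simp
  then have "g \<otimes> inv ?c = inv ?c \<otimes> g"
    using cG assms(2) by (simp add: m_assoc inv_mult_cancel_left)
  moreover have "commutator G g x = g \<otimes> inv ?c"
    using assms xG by (simp add: commutator_def word_simps)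
  ultimately have "g \<otimes> commutator G g x = commutator G g x \<otimes> g"
    using assms(2) cG by (simp add: m_assoc [symmetric])
  then show ?thesis
    using assms xG by (simp add: commutator_eq_one_iff)
qed

text \<open>Since \<open>gx\<close> and \<open>g\<close> have the same commutator \<open>d\<close> with \<open>x\<close>, the Engel identity makes
  both of them commute with \<open>d\<close>. Hence so does \<open>x\<close>, and the conjugate in question is \<open>dx\<close>.\<close>

lemma centralizer_norm_commute_conj:
  assumes "x \<in> centralizer_norm G" "g \<in> carrier G"
  shows "(g \<otimes> x \<otimes> inv g) \<otimes> x = x \<otimes> (g \<otimes> x \<otimes> inv g)"
proof -
  have xG: "x \<in> carrier G"
    using assms by (simp add: centralizer_norm_iff)
  let ?d = "commutator G g x"
  have dG: "?d \<in> carrier G"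
    using assms xG by simp
  have 1: "g \<otimes> ?d = ?d \<otimes> g"
    using centralizer_norm_right_engel [OF assms] assms xG by (simp add: commutator_eq_one_iff)
  have "commutator G (g \<otimes> x) x = ?d"
    using assms xG by (simp add: commutator_def word_simps)
  then have "g \<otimes> x \<otimes> ?d = ?d \<otimes> (g \<otimes> x)"
    using centralizer_norm_right_engel [OF assms(1), of "g \<otimes> x"] assms xG
    by (simp add: commutator_eq_one_iff)
  also have "\<dots> = g \<otimes> (?d \<otimes> x)"
    using 1 assms xG dG by (metis m_assoc)
  finally have 2: "x \<otimes> ?d = ?d \<otimes> x"
    using assms xG dG by (simp add: m_assoc)
  have "g \<otimes> x \<otimes> inv g = ?d \<otimes> x"
    using assms xG by (simp add: commutator_def word_simps)
  then show ?thesis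
    using 2 xG dG by (metis m_assoc)
qed

text \<open>In \<open>G/N\<close> the hypothesis says that the elements of \<open>S\<close> lie in the centralizer of the image of
  \<open>x\<close>, which is a subgroup. So centrality modulo \<open>N\<close> needs checking on generators only.\<close>

lemma commutator_in_normal_generated:
  assumes "N \<lhd> G" "x \<in> carrier G" "S \<subseteq> carrier G"
    and S: "\<And>s. s \<in> S \<Longrightarrow> commutator G s x \<in> N"
    and g: "g \<in> generate G S"
  shows "commutator G g x \<in> N"
  using g
proof induction
  interpret normal N G by fact
  {
    case one
    then show ?case using assms(2) by (simp add: commutator_def)
  next
    case (incl h)
    then show ?case by (rule S)
  next
    case (inv h)
    then show ?case
      using S assms by (simp add: commutator_inv_left inv_op_closed1 subset_iff)
  next
    case (eng g h)
    then have "g \<in> carrier G" "h \<in> carrier G"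
      using generate_in_carrier assms(3) by blast+
    then show ?case
      using eng assms(2) by (simp add: commutator_mult_left inv_op_closed2)
  }
qed

end

section \<open>Abelian normal subgroups with square-zero commutation\<close>

locale right_engel_module = group G for G (structure) +
  fixes V
  assumes V_normal: "V \<lhd> G"
    and V_commute: "u \<in> V \<Longrightarrow> v \<in> V \<Longrightarrow> u \<otimes> v = v \<otimes> u"
    and V_engel: "v \<in> V \<Longrightarrow> g \<in> carrier G \<Longrightarrow> commutator G g (commutator G g v) = \<one>"
begin

lemma V_carrier: "v \<in> V \<Longrightarrow> v \<in> carrier G"
  by (rule normal_in_carrier [OF V_normal])

lemma V_mult: "u \<in> V \<Longrightarrow> v \<in> V \<Longrightarrow> u \<otimes> v \<in> V"
  by (rule subgroup.m_closed [OF normal_imp_subgroup [OF V_normal]])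

lemma V_commutator: "v \<in> V \<Longrightarrow> g \<in> carrier G \<Longrightarrow> commutator G g v \<in> V"
  by (rule commutator_in_normal [OF V_normal])

lemma commutator_V_mult:
  assumes "u \<in> V" "v \<in> V" "g \<in> carrier G"
  shows "commutator G g (u \<otimes> v) = commutator G g u \<otimes> commutator G g v"
proof -
  have "u \<otimes> commutator G g v \<otimes> inv u = commutator G g v"
    using V_commute [OF assms(1) V_commutator [OF assms(2,3)]] assms
    by (simp add: V_carrier m_assoc)
  then show ?thesis
    using assms by (simp add: commutator_mult_right V_carrier)
qed

lemma commutator_mult_V:
  assumes "v \<in> V" "g \<in> carrier G" "h \<in> carrier G"
  shows "commutator G (g \<otimes> h) v =
    commutator G g (commutator G h v) \<otimes> (commutator G h v \<otimes> commutator G g v)"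
  using assms by (simp add: commutator_def word_simps V_carrier)

text \<open>From \<open>gh - 1 = \<alpha>\<beta> + \<alpha> + \<beta>\<close> with \<open>\<alpha> = g - 1\<close> and \<open>\<beta> = h - 1\<close>, the expansion of
  \<open>(gh - 1)\<^sup>2 = 0\<close> leaves, as \<open>\<alpha>\<^sup>2 = \<beta>\<^sup>2 = 0\<close>, the relation
  \<open>\<alpha>\<beta>\<alpha>\<beta> + \<alpha>\<beta>\<alpha> + \<beta>\<alpha>\<beta> + \<beta>\<alpha> + \<alpha>\<beta> = 0\<close>.\<close>

lemma engel_linearized:
  assumes v: "v \<in> V" and g: "g \<in> carrier G" and h: "h \<in> carrier G"
  defines "a \<equiv> commutator G g" and "b \<equiv> commutator G h"
  shows "a (b (a (b v))) \<otimes> (a (b (a v)) \<otimes> (b (a (b v)) \<otimes> (b (a v) \<otimes> a (b v)))) = \<one>"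
proof -
  have V: "a u \<in> V" "b u \<in> V" if "u \<in> V" for u
    using that g h by (simp_all add: a_def b_def V_commutator)
  have mult: "a (u \<otimes> w) = a u \<otimes> a w" "b (u \<otimes> w) = b u \<otimes> b w" if "u \<in> V" "w \<in> V" for u w
    using that g h by (simp_all add: a_def b_def commutator_V_mult)
  have sq: "a (a u) = \<one>" "b (b u) = \<one>" if "u \<in> V" for u
    using that g h by (simp_all add: a_def b_def V_engel)
  have one: "a \<one> = \<one>" "b \<one> = \<one>"
    using g h by (simp_all add: a_def b_def)
  have prod: "commutator G (g \<otimes> h) u = a (b u) \<otimes> (b u \<otimes> a u)" if "u \<in> V" for u
    using that g h by (simp add: a_def b_def commutator_mult_V)
  have "commutator G (g \<otimes> h) (commutator G (g \<otimes> h) v) = \<one>"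
    using v g h by (simp add: V_engel)
  then show ?thesis
    using v by (simp add: prod mult sq one V V_mult V_carrier m_assoc)
qed

text \<open>Multiplying the relation of \<open>engel_linearized\<close> by \<open>\<beta>\<close> on the right leaves
  \<open>\<alpha>\<beta>\<alpha>\<beta> + \<beta>\<alpha>\<beta> = 0\<close>, and a further \<open>\<alpha>\<close> on the left leaves \<open>\<alpha>\<beta>\<alpha>\<beta> = 0\<close>. So
  \<open>\<beta>\<alpha>\<beta> = 0\<close>, by symmetry \<open>\<alpha>\<beta>\<alpha> = 0\<close>, and only \<open>\<beta>\<alpha> + \<alpha>\<beta> = 0\<close> remains.\<close>

lemma commutators_anticommute:
  assumes v: "v \<in> V" and g: "g \<in> carrier G" and h: "h \<in> carrier G"
  shows "commutator G h (commutator G g v) \<otimes> commutator G g (commutator G h v) = \<one>"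
proof -
  have triple: "commutator G y (commutator G x (commutator G y u)) = \<one>"
    if u: "u \<in> V" and x: "x \<in> carrier G" and y: "y \<in> carrier G" for x y u
  proof -
    define a b where ab: "a = commutator G x" "b = commutator G y"
    have V: "a u \<in> V" "b u \<in> V" if "u \<in> V" for u
      using that x y by (simp_all add: ab V_commutator)
    have mult: "a (u \<otimes> w) = a u \<otimes> a w" if "u \<in> V" "w \<in> V" for u w
      using that x y by (simp add: ab commutator_V_mult)
    have sq: "a (a u) = \<one>" "b (b u) = \<one>" if "u \<in> V" for u
      using that x y by (simp_all add: ab V_engel)
    have one: "a \<one> = \<one>" "b \<one> = \<one>"
      using x y by (simp_all add: ab)
    have E: "a (b (a (b u))) \<otimes> b (a (b u)) = \<one>"
      using engel_linearized [OF V(2) x y] u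
      by (simp add: ab [symmetric] sq one V V_carrier)
    then have "a (a (b (a (b u))) \<otimes> b (a (b u))) = \<one>"
      using one by simp
    then have "a (b (a (b u))) = \<one>"
      using u by (simp add: mult sq V V_carrier)
    then have "b (a (b u)) = \<one>"
      using E u by (simp add: V V_carrier)
    then show ?thesis by (simp add: ab)
  qed
  show ?thesis
    using engel_linearized [OF v g h] triple v g h
    by (simp add: V_commutator V_carrier)
qed

text \<open>The set \<open>T\<close> collects generators already known to commute with \<open>v\<close>. Commutation of \<open>v\<close> with
  another generator \<open>s\<close> enlarges it by \<open>s\<close>: the members of \<open>T\<close> still act trivially by
  anticommutation, and \<open>s\<close> does because its operator has square zero. Hence the induction on the
  number of generators outside \<open>T\<close>.\<close>

lemma in_upper_central:
  assumes S: "finite S" "S \<subseteq> carrier G" "generate G S = carrier G"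
    and "T \<subseteq> S" "v \<in> V" "\<And>t. t \<in> T \<Longrightarrow> commutator G t v = \<one>"
  shows "v \<in> upper_central_over G {\<one>} (Suc (card (S - T)))"
  using assms(4-6)
proof (induction "card (S - T)" arbitrary: T v rule: less_induct)
  case less
  let ?U = "upper_central_over G {\<one>} (card (S - T))"
  have U: "?U \<lhd> G"
    by (rule upper_central_over_normal [OF one_is_normal])
  have "commutator G s v \<in> ?U" if s: "s \<in> S" for s
  proof (cases "s \<in> T")
    case True
    then show ?thesis
      using less.prems subgroup.one_closed [OF normal_imp_subgroup [OF U]] by simp
  next
    case False
    have sG: "s \<in> carrier G"
      using s S by blast
    have card: "card (S - T) = Suc (card (S - insert s T))"
      using s False S(1) by (metis Diff_iff Diff_insert card_Suc_Diff1 finite_Diff)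
    have "commutator G t (commutator G s v) = \<one>" if t: "t \<in> insert s T" for t
    proof (cases "t = s")
      case True
      then show ?thesis
        using V_engel less.prems sG by simp
    next
      case False
      then have "t \<in> T" and tG: "t \<in> carrier G"
        using t less.prems S by auto
      then show ?thesis
        using commutators_anticommute [OF \<open>v \<in> V\<close> sG tG] less.prems sG
        by (simp add: V_carrier)
    qed
    then have "commutator G s v \<in> upper_central_over G {\<one>} (Suc (card (S - insert s T)))"
      using less.prems s card by (intro less.hyps) (auto simp: V_commutator sG)
    then show ?thesis
      using card by simp
  qed
  then have "commutator G g v \<in> ?U" if "g \<in> carrier G" for g
    using commutator_in_normal_generated [OF U V_carrier [OF \<open>v \<in> V\<close>] S(2)] that S(3) by blast
  then show ?case
    using V_carrier less.prems by simp
qed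

end

section \<open>Descent along the series\<close>

context group
begin

text \<open>This is where the operator argument is applied to the group itself: every element of the norm
  lies in some \<open>V\<close> satisfying \<open>right_engel_module\<close>.\<close>

lemma centralizer_norm_subset_upper_central:
  assumes "finite S" "S \<subseteq> carrier G" "generate G S = carrier G"
  shows "centralizer_norm G \<subseteq> upper_central_over G {\<one>} (Suc (card S))"
proof
  fix x
  assume x: "x \<in> centralizer_norm G"
  then have xG: "x \<in> carrier G"
    by (simp add: centralizer_norm_iff)
  interpret A: normal "centralizer_norm G" G
    by (rule centralizer_norm_normal)
  \<comment> \<open>\<open>W\<close> centralizes the conjugates of \<open>x\<close>, and \<open>V\<close> is the part of \<open>C(G)\<close> in the double
    centralizer. As these conjugates commute with each other they lie in \<open>W\<close>, so that \<open>V\<close> lies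
    in \<open>W\<close> and is abelian. This replaces the normal closure of \<open>x\<close> and needs no
    induction over generated elements.\<close>
  define W where "W = {w \<in> carrier G. \<forall>g \<in> carrier G. commutator G w (g \<otimes> x \<otimes> inv g) = \<one>}"
  define V where "V = {v \<in> centralizer_norm G. \<forall>w \<in> W. commutator G w v = \<one>}"
  have WG: "w \<in> carrier G" if "w \<in> W" for w
    using that by (simp add: W_def)
  have VG: "v \<in> carrier G" if "v \<in> V" for v
    using that by (simp add: V_def)
  have conj_W: "inv h \<otimes> w \<otimes> h \<in> W" if w: "w \<in> W" and h: "h \<in> carrier G" for w h
  proof -
    have wG: "w \<in> carrier G" by (rule WG) fact
    have "commutator G (inv h \<otimes> w \<otimes> h) (g \<otimes> x \<otimes> inv g) =
        inv h \<otimes> commutator G w ((h \<otimes> g) \<otimes> x \<otimes> inv (h \<otimes> g)) \<otimes> h" if "g \<in> carrier G" for g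
      using that h wG xG by (simp add: commutator_def word_simps)
    then show ?thesis
      using w h wG by (simp add: W_def)
  qed
  have x_W: "g \<otimes> x \<otimes> inv g \<in> W" if g: "g \<in> carrier G" for g
  proof -
    have "commutator G (g \<otimes> x \<otimes> inv g) (h \<otimes> x \<otimes> inv h) = \<one>" if h: "h \<in> carrier G" for h
    proof -
      let ?k = "inv h \<otimes> g"
      have "commutator G (?k \<otimes> x \<otimes> inv ?k) x = \<one>"
        using centralizer_norm_commute_conj [OF x, of ?k] g h xG by (simp add: commutator_eq_one_iff)
      moreover have "inv h \<otimes> (g \<otimes> x \<otimes> inv g) \<otimes> h = ?k \<otimes> x \<otimes> inv ?k"
        using g h xG by (simp add: word_simps)
      ultimately show ?thesis
        using g h xG by (simp add: commutator_conj_right)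
    qed
    then show ?thesis
      using g xG by (simp add: W_def)
  qed
  have V_W: "v \<in> W" if v: "v \<in> V" for v
  proof -
    have "commutator G v (g \<otimes> x \<otimes> inv g) = \<one>" if g: "g \<in> carrier G" for g
    proof -
      have "commutator G (g \<otimes> x \<otimes> inv g) v = \<one>"
        using v x_W [OF g] by (simp add: V_def)
      then show ?thesis
        using VG [OF v] g xG by (simp add: commutator_eq_one_iff)
    qed
    then show ?thesis
      using VG [OF v] by (simp add: W_def)
  qed
  have V_normal: "V \<lhd> G"
  proof (rule normal_invI)
    show "subgroup V G"
    proof
      show "V \<subseteq> carrier G"
        using VG by blast
      show "\<one> \<in> V"
        using WG by (simp add: V_def)
    next
      fix u v
      assume "u \<in> V" "v \<in> V"
      then show "u \<otimes> v \<in> V"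
        using WG by (simp add: V_def commutator_mult_right)
    next
      fix v
      assume "v \<in> V"
      then show "inv v \<in> V"
        using WG by (simp add: V_def commutator_inv_right)
    qed
  next
    fix h v
    assume "h \<in> carrier G" "v \<in> V"
    then show "h \<otimes> v \<otimes> inv h \<in> V"
      using WG conj_W by (simp add: V_def commutator_conj_right A.inv_op_closed2)
  qed
  interpret right_engel_module G V
  proof (intro right_engel_module.intro right_engel_module_axioms.intro)
    show "group G" by (rule is_group)
  next
    show "V \<lhd> G" by (rule V_normal)
  next
    fix u v
    assume u: "u \<in> V" and v: "v \<in> V"
    have "commutator G u v = \<one>"
      using v V_W [OF u] unfolding V_def by blast
    then show "u \<otimes> v = v \<otimes> u"
      using commutator_eq_one_iff [OF VG [OF u] VG [OF v]] by blast
  next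
    fix v g
    assume "v \<in> V" "g \<in> carrier G"
    then show "commutator G g (commutator G g v) = \<one>"
      by (simp add: V_def centralizer_norm_right_engel)
  qed
  have "commutator G w x = \<one>" if w: "w \<in> W" for w
  proof -
    have "commutator G w (\<one> \<otimes> x \<otimes> inv \<one>) = \<one>"
      using w unfolding W_def by blast
    then show ?thesis
      using xG by simp
  qed
  then have "x \<in> V"
    using x by (simp add: V_def)
  then show "x \<in> upper_central_over G {\<one>} (Suc (card S))"
    using in_upper_central [OF assms, of "{}" x] by simp
qed

lemma centralizer_norm_series_Suc_subset:
  assumes "finitely_generated G"
  obtains k where
    "centralizer_norm_series G (Suc i) \<subseteq> upper_central_over G (centralizer_norm_series G i) k"
proof -
  let ?C = "centralizer_norm_series G i"
  obtain S where S: "finite S" "S \<subseteq> carrier G" "generate G S = carrier G"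
    using assms unfolding finitely_generated_def by blast
  note C = centralizer_norm_series_normal [of i]
  interpret hom: group_hom G "G Mod ?C" "\<lambda>x. ?C #> x"
    by (rule group_hom_quotient [OF C])
  let ?T = "(\<lambda>x. ?C #> x) ` S"
  have "generate (G Mod ?C) ?T = carrier (G Mod ?C)"
    using hom.generate_img [OF S(2)] S(3) by (simp add: carrier_FactGroup)
  then have "centralizer_norm (G Mod ?C) \<subseteq>
      upper_central_over (G Mod ?C) {\<one>\<^bsub>G Mod ?C\<^esub>} (Suc (card ?T))"
    using S by (intro hom.H.centralizer_norm_subset_upper_central) (auto simp: carrier_FactGroup)
  then have "x \<in> upper_central_over G ?C (Suc (card ?T))"
    if "x \<in> centralizer_norm_series G (Suc i)" for x
    using that upper_central_over_quotient_iff [OF C, of x]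
    by (simp only: centralizer_norm_series.simps mem_Collect_eq) blast
  then have "centralizer_norm_series G (Suc i) \<subseteq> upper_central_over G ?C (Suc (card ?T))"
    by blast
  then show thesis by (rule that)
qed

lemma nilpotent_if_upper_central_over_centralizer_norm_series:
  assumes "finitely_generated G" "upper_central_over G (centralizer_norm_series G m) n = carrier G"
  shows "nilpotent G"
  using assms(2)
proof (induction m arbitrary: n)
  case 0
  then show ?case
    using nilpotent_iff_upper_central by auto
next
  case (Suc m)
  let ?C = "centralizer_norm_series G"
  obtain k where "?C (Suc m) \<subseteq> upper_central_over G (?C m) k"
    using centralizer_norm_series_Suc_subset [OF assms(1)] by blast
  from upper_central_over_mono [OF this, of n]
  have "carrier G \<subseteq> upper_central_over G (?C m) (n + k)"
    using Suc.prems by (simp only: upper_central_over_add)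
  moreover have "?C m \<subseteq> carrier G"
    using centralizer_norm_series_normal normal_in_carrier by blast
  ultimately have "upper_central_over G (?C m) (n + k) = carrier G"
    using upper_central_over_subset by blast
  then show ?case
    by (rule Suc.IH)
qed

end

theorem mainTheorem1:
  fixes G :: "('a, 'b) monoid_scheme"
  assumes "group G"
    and "finitely_generated G"
  shows "(nilpotent G \<longleftrightarrow> (\<exists>n::nat. n > 0 \<and> carrier G = centralizer_norm_series G n)) \<and>
         (nilpotent G \<longleftrightarrow> (\<exists>m::nat. m > 0 \<and> nilpotent (G Mod centralizer_norm_series G m)))"
proof -
  interpret group G by fact
  let ?C = "centralizer_norm_series G"
  have quotient: "nilpotent (G Mod ?C m) \<longleftrightarrow> (\<exists>n. upper_central_over G (?C m) n = carrier G)" for m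
    by (rule nilpotent_quotient_iff [OF centralizer_norm_series_normal])
  have 12: "\<exists>n>0. carrier G = ?C n" if nil: "nilpotent G"
  proof -
    obtain n where "upper_central_over G {\<one>\<^bsub>G\<^esub>} n = carrier G"
      using nil nilpotent_iff_upper_central by blast
    \<comment> \<open>One extra step, because \<open>n\<close> may be zero when \<open>G\<close> is trivial.\<close>
    then have "carrier G \<subseteq> ?C (Suc n)"
      using upper_central_over_Suc_mono [OF one_is_normal]
        upper_central_subset_centralizer_norm_series by blast
    then have "carrier G = ?C (Suc n)"
      using centralizer_norm_series_normal normal_in_carrier by blast
    then show ?thesis by blast
  qed
  have 23: "\<exists>m>0. nilpotent (G Mod ?C m)" if "\<exists>n>0. carrier G = ?C n"
    using that quotient upper_central_over.simps(1) by metis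
  have 31: "nilpotent G" if "\<exists>m>0. nilpotent (G Mod ?C m)"
    using that quotient nilpotent_if_upper_central_over_centralizer_norm_series [OF assms(2)] by blast
  show ?thesis
    using 12 23 31 by blast
qed

end
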